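(* Let $d\ge1$ and let $\Lambda_\Phi\subset[0,1]^d$ be a strongly Lalley–Gatzouras sponge. If $\Lambda_\Phi$ is reducible (i.e. not irreducible), then no nonempty subset of $\Lambda_\Phi$ is hyperplane diffuse.
   Context: Diagonal IFS and self-affine sponge. Let $D=\{1,\ldots,d\}$. For each $i\in D$ let $A_i$ be a finite index set and $\Phi_i=(\phi_{i,a})_{a\in A_i}$ a finite collection of contracting similarities $[0,1]\to[0,1]$ (the base IFS in coordinate $i$). Let $A=\prod_{i\in D}A_i$, and for $\mathbf{a}=(a_1,\ldots,a_d)\in A$ let $\phi_{\mathbf{a}}(x_1,\ldots,x_d)=(\phi_{\mathbf{a},1}(x_1),\ldots,\phi_{\mathbf{a},d}(x_d))$, where $\phi_{\mathbf{a},i}:=\phi_{i,a_i}$. The constant $|\phi_{\mathbf{a},i}'|\in(0,1)$ is the contraction ratio of $\phi_{\mathbf{a},i}$. For nonempty $E\subset A$ the collection $\Phi=(\phi_{\mathbf{a}})_{\mathbf{a}\in E}$ is called a diagonal IFS. Its coding map is $\pi:E^{\mathbb{N}}\to[0,1]^d$, $\pi(\omega)=\lim_{n\to\infty}\phi_{\omega_1}\circ\cdots\circ\phi_{\omega_n}(\mathbf{0})$, and its limit set $\Lambda_\Phi=\pi(E^{\mathbb{N}})$ is called a self-affine sponge. Properties of the data $\Phi$ are, by abuse of language, attributed to $\Lambda_\Phi$. For $I\subset D$ let $\pi_I:A\to\prod_{i\in I}A_i$ be the projection, and for $\mathbf{a}\in\pi_I(E)$ let $\phi_{I,\mathbf{a}}:[0,1]^I\to[0,1]^I$,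 $\phi_{I,\mathbf{a}}(\mathbf{x})=(\phi_{i,a_i}(x_i))_{i\in I}$. The set $I$ is strongly good if the sets $\phi_{I,\mathbf{a}}([0,1]^I)$, $\mathbf{a}\in\pi_I(E)$, are pairwise disjoint. The sponge $\Lambda_\Phi$ is strongly Lalley–Gatzouras if there is a permutation $\sigma$ of $D$ such that (coordinate ordering) $|\phi_{\mathbf{a},\sigma(1)}'|>|\phi_{\mathbf{a},\sigma(2)}'|>\cdots>|\phi_{\mathbf{a},\sigma(d)}'|$ for all $\mathbf{a}\in E$, and (disjointness) the coordinate sets $\sigma(\{1,\ldots,i\})$, $i=1,\ldots,d$, are all strongly good. For $i,j\in D$ write $i\prec j$ (equivalently $j\succ i$) if $|\phi_{\mathbf{a},i}'|\ge|\phi_{\mathbf{a},j}'|$ for all $\mathbf{a}\in E$ (so $i\prec i$). The sponge is irreducible if for every $i\in D$ there exist $\mathbf{a},\mathbf{b}\in E$ such that $a_i\ne b_i$ and $\{j\in D:a_j\ne b_j\}\subset\{j\in D:j\succ i\}$. A set $K\subset\mathbb{R}^d$ is hyperplane diffuse if there exists $\beta>0$ such that for all $0<\rho\le1$, all $\mathbf{x}\in K$ and every affine hyperplane $\mathcal{L}\subset\mathbb{R}^d$, the set $(B(\mathbf{x},\rho)\cap K)\setminus\{\mathbf{y}:\mathrm{dist}(\mathbf{y},\mathcal{L})\le\beta\rho\}$ is nonempty. *)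

theory Defs
  imports "HOL-Analysis.Analysis"
begin

text \<open>
  The coordinate set \<open>D\<close> is the finite type \<open>'n\<close>, so \<open>d = CARD('n)\<close> and the sponge lives in
  \<open>real ^ 'n\<close>. All index sets \<open>A i\<close> are finite subsets of one type \<open>'a\<close>. Only the values of the base
  maps \<open>\<phi> i a :: real \<Rightarrow> real\<close> on \<open>[0,1]\<close> are constrained.
\<close>

definition similarity_with_ratio :: "real \<Rightarrow> (real \<Rightarrow> real) \<Rightarrow> bool" where
  "similarity_with_ratio r f \<longleftrightarrow>
     (\<forall>x\<in>{0..1}. \<forall>y\<in>{0..1}. dist (f x) (f y) = r * dist x y)"

definition contracting_similarity :: "(real \<Rightarrow> real) \<Rightarrow> bool" where
  "contracting_similarity f \<longleftrightarrow>
     f ` {0..1} \<subseteq> {0..1} \<and> (\<exists>r. 0 < r \<and> r < 1 \<and> similarity_with_ratio r f)"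

text \<open>The constant \<open>|f'|\<close> of a similarity \<open>f\<close> of \<open>[0,1]\<close>.\<close>

definition contraction_ratio :: "(real \<Rightarrow> real) \<Rightarrow> real" where
  "contraction_ratio f = (THE r. similarity_with_ratio r f)"

definition diagonal_IFS ::
    "('n::finite \<Rightarrow> 'a set) \<Rightarrow> ('n \<Rightarrow> 'a \<Rightarrow> real \<Rightarrow> real) \<Rightarrow> ('n \<Rightarrow> 'a) set \<Rightarrow> bool" where
  "diagonal_IFS A \<phi> E \<longleftrightarrow>
     (\<forall>i. finite (A i) \<and> (\<forall>a\<in>A i. contracting_similarity (\<phi> i a))) \<and>
     E \<noteq> {} \<and> E \<subseteq> Pi\<^sub>E UNIV A"

definition ratio :: "('n \<Rightarrow> 'a \<Rightarrow> real \<Rightarrow> real) \<Rightarrow> ('n \<Rightarrow> 'a) \<Rightarrow> 'n \<Rightarrow> real" where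
  "ratio \<phi> a i = contraction_ratio (\<phi> i (a i))"

definition diag_map ::
    "('n::finite \<Rightarrow> 'a \<Rightarrow> real \<Rightarrow> real) \<Rightarrow> ('n \<Rightarrow> 'a) \<Rightarrow> real ^ 'n \<Rightarrow> real ^ 'n" where
  "diag_map \<phi> a x = (\<chi> i. \<phi> i (a i) (x $ i))"

text \<open>Words are indexed from 0: \<open>\<omega> 0\<close> is the first letter and gives the outermost map.\<close>

definition coding_map ::
    "('n::finite \<Rightarrow> 'a \<Rightarrow> real \<Rightarrow> real) \<Rightarrow> (nat \<Rightarrow> 'n \<Rightarrow> 'a) \<Rightarrow> real ^ 'n" where
  "coding_map \<phi> \<omega> = lim (\<lambda>n. foldr (\<lambda>k. diag_map \<phi> (\<omega> k)) [0..<n] 0)"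

definition sponge ::
    "('n::finite \<Rightarrow> 'a \<Rightarrow> real \<Rightarrow> real) \<Rightarrow> ('n \<Rightarrow> 'a) set \<Rightarrow> (real ^ 'n) set" where
  "sponge \<phi> E = coding_map \<phi> ` {\<omega>. \<forall>n. \<omega> n \<in> E}"

text \<open>
  Elements of \<open>\<Prod>i\<in>I. A i\<close> and of \<open>[0,1]\<^sup>I\<close> are extensional functions on \<open>I\<close>; thus
  \<open>restrict a I\<close> is the image of \<open>a\<close> under the projection \<open>A \<rightarrow> \<Prod>i\<in>I. A i\<close>.
\<close>

definition partial_map ::
    "('n \<Rightarrow> 'a \<Rightarrow> real \<Rightarrow> real) \<Rightarrow> 'n set \<Rightarrow> ('n \<Rightarrow> 'a) \<Rightarrow> ('n \<Rightarrow> real) \<Rightarrow> ('n \<Rightarrow> real)" where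
  "partial_map \<phi> I a x = (\<lambda>i\<in>I. \<phi> i (a i) (x i))"

definition strongly_good ::
    "('n \<Rightarrow> 'a \<Rightarrow> real \<Rightarrow> real) \<Rightarrow> ('n \<Rightarrow> 'a) set \<Rightarrow> 'n set \<Rightarrow> bool" where
  "strongly_good \<phi> E I \<longleftrightarrow>
     disjoint_family_on (\<lambda>a. partial_map \<phi> I a ` (I \<rightarrow>\<^sub>E {0..1})) ((\<lambda>a. restrict a I) ` E)"

text \<open>
  As \<open>'n\<close> carries no distinguished enumeration, a permutation of \<open>D\<close> becomes a
  bijection \<open>\<sigma>\<close> from \<open>{1..d}\<close> to \<open>'n\<close>.
\<close>

definition strongly_Lalley_Gatzouras ::
    "('n::finite \<Rightarrow> 'a \<Rightarrow> real \<Rightarrow> real) \<Rightarrow> ('n \<Rightarrow> 'a) set \<Rightarrow> bool" where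
  "strongly_Lalley_Gatzouras \<phi> E \<longleftrightarrow>
     (\<exists>\<sigma>. bij_betw \<sigma> {1..CARD('n)} (UNIV :: 'n set) \<and>
        (\<forall>a\<in>E. \<forall>k\<in>{1..<CARD('n)}. ratio \<phi> a (\<sigma> k) > ratio \<phi> a (\<sigma> (Suc k))) \<and>
        (\<forall>k\<in>{1..CARD('n)}. strongly_good \<phi> E (\<sigma> ` {1..k})))"

definition coord_prec ::
    "('n \<Rightarrow> 'a \<Rightarrow> real \<Rightarrow> real) \<Rightarrow> ('n \<Rightarrow> 'a) set \<Rightarrow> 'n \<Rightarrow> 'n \<Rightarrow> bool" where
  "coord_prec \<phi> E i j \<longleftrightarrow> (\<forall>a\<in>E. ratio \<phi> a i \<ge> ratio \<phi> a j)"

definition irreducible_sponge ::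
    "('n \<Rightarrow> 'a \<Rightarrow> real \<Rightarrow> real) \<Rightarrow> ('n \<Rightarrow> 'a) set \<Rightarrow> bool" where
  "irreducible_sponge \<phi> E \<longleftrightarrow>
     (\<forall>i. \<exists>a\<in>E. \<exists>b\<in>E. a i \<noteq> b i \<and> {j. a j \<noteq> b j} \<subseteq> {j. coord_prec \<phi> E i j})"

definition affine_hyperplane :: "'b::euclidean_space set \<Rightarrow> bool" where
  "affine_hyperplane L \<longleftrightarrow> (\<exists>v c. v \<noteq> 0 \<and> L = {y. v \<bullet> y = c})"

text \<open>Balls are closed; with open balls the notion is the same, up to changing \<open>\<beta>\<close>.\<close>

definition hyperplane_diffuse :: "'b::euclidean_space set \<Rightarrow> bool" where
  "hyperplane_diffuse K \<longleftrightarrow>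
     (\<exists>\<beta>>0. \<forall>\<rho>. 0 < \<rho> \<and> \<rho> \<le> 1 \<longrightarrow>
        (\<forall>x\<in>K. \<forall>L. affine_hyperplane L \<longrightarrow>
           (cball x \<rho> \<inter> K) - {y. infdist y L \<le> \<beta> * \<rho>} \<noteq> {}))"

end

theory Submission
  imports Defs
begin

text \<open>
  Order the coordinates by decreasing contraction ratio. If the sponge is reducible at the coordinate
  \<open>i\<close>, then the coordinates \<open>I\<close> before \<open>i\<close> of a letter of \<open>E\<close> determine its \<open>i\<close>-th coordinate. As
  \<open>I\<close> is strongly good, points of the sponge at distance less than a fixed multiple of the smallest
  side in the directions \<open>I\<close> of the cylinder of \<open>x\<close> of level \<open>n\<close> have the same first \<open>n\<close> letters as \<open>x\<close> in
  the coordinates \<open>I\<close>, hence in the coordinate \<open>i\<close>. So their \<open>i\<close>-th coordinates differ by at most the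
  side of this cylinder in the direction \<open>i\<close>, which is smaller by a factor exponentially small in \<open>n\<close>:
  near \<open>x\<close> the sponge is too close to the hyperplane \<open>y\<^sub>i = x\<^sub>i\<close>.
\<close>

section \<open>Contracting similarities of the unit interval and their infinite compositions\<close>

text \<open>The distance between the images of 0 and 1 determines the ratio, so the definite
  description is meaningful.\<close>

lemma contraction_ratio_eqI:
  assumes "similarity_with_ratio r f"
  shows "contraction_ratio f = r"
  unfolding contraction_ratio_def
proof (rule the_equality[where P="\<lambda>r. similarity_with_ratio r f", OF assms])
  fix s assume "similarity_with_ratio s f"
  then have "dist (f 0) (f 1) = s * dist (0::real) 1"
    unfolding similarity_with_ratio_def by auto
  moreover have "dist (f 0) (f 1) = r * dist (0::real) 1"
    using assms unfolding similarity_with_ratio_def by auto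
  ultimately show "s = r" by simp
qed

lemma contracting_similarity_ratio:
  assumes "contracting_similarity f"
  shows "0 < contraction_ratio f" "contraction_ratio f < 1"
    and "similarity_with_ratio (contraction_ratio f) f"
  using assms contraction_ratio_eqI unfolding contracting_similarity_def by metis+

lemma contracting_similarity_mem:
  "contracting_similarity f \<Longrightarrow> t \<in> {0..1} \<Longrightarrow> f t \<in> {0..1}"
  unfolding contracting_similarity_def by blast

lemma contracting_similarity_continuous_on:
  assumes "contracting_similarity f"
  shows "continuous_on {0..1} f"
proof (rule lipschitz_on_continuous_on)
  show "(contraction_ratio f)-lipschitz_on {0..1} f"
    using contracting_similarity_ratio[OF assms]
    by (intro lipschitz_onI) (auto simp: similarity_with_ratio_def)
qed

lemma foldr_similarity_mem:
  assumes "\<And>k. contracting_similarity (f k)" "t \<in> {0..1}"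
  shows "foldr f xs t \<in> {0..1}"
  using assms(2)
proof (induction xs)
  case (Cons k xs)
  then show ?case using contracting_similarity_mem[OF assms(1)] by simp
qed simp

lemma dist_foldr_similarity:
  assumes f: "\<And>k. contracting_similarity (f k)" and "s \<in> {0..1}" "t \<in> {0..1}"
  shows "dist (foldr f [0..<n] s) (foldr f [0..<n] t) =
    (\<Prod>k<n. contraction_ratio (f k)) * dist s t"
  using assms(2,3)
proof (induction n arbitrary: s t)
  case (Suc n)
  have "dist (f n s) (f n t) = contraction_ratio (f n) * dist s t"
    using contracting_similarity_ratio(3)[OF f] Suc.prems unfolding similarity_with_ratio_def by blast
  then show ?case
    using Suc.IH[OF contracting_similarity_mem[OF f Suc.prems(1)] contracting_similarity_mem[OF f Suc.prems(2)]]
    by simp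
qed simp

lemma foldr_upt_split:
  assumes "n \<le> m"
  shows "foldr f [0..<m] t = foldr f [0..<n] (foldr f [n..<m] t)"
proof -
  have "[0..<m] = [0..<n] @ [n..<m]"
    using upt_add_eq_append[of 0 n "m - n"] assms by simp
  then show ?thesis by simp
qed

text \<open>The images of \<open>{0..1}\<close> under the compositions of the first \<open>n\<close>
  maps are nested, with diameters at most \<open>\<theta> ^ n\<close>. Hence the values at 0 form a
  Cauchy sequence, and as each image is compact, the limit stays in all of them. The second
  conclusion is the one that later estimates need.\<close>

lemma foldr_similarity_limit:
  assumes f: "\<And>k. contracting_similarity (f k)"
    and \<theta>: "\<theta> < 1" "\<And>k. contraction_ratio (f k) \<le> \<theta>"
  obtains l where "(\<lambda>n. foldr f [0..<n] 0) \<longlonglongrightarrow> l"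
    and "\<And>n. \<exists>t\<in>{0..1}. l = foldr f [0..<n] t"
proof -
  let ?s = "\<lambda>n. foldr f [0..<n] 0"
  have tail: "\<exists>t\<in>{0..1}. ?s m = foldr f [0..<n] t" if "n \<le> m" for n m
    using foldr_upt_split[OF that, of f 0] foldr_similarity_mem[of f 0, OF f]
    by (intro bexI[of _ "foldr f [n..<m] 0"]) auto
  have prod_le: "(\<Prod>k<n. contraction_ratio (f k)) \<le> \<theta> ^ n" for n
    using prod_mono[of "{..<n}" "\<lambda>k. contraction_ratio (f k)" "\<lambda>_. \<theta>"]
      contracting_similarity_ratio(1)[OF f] \<theta>(2) by (simp add: less_imp_le)
  have \<theta>0: "0 < \<theta>"
    using contracting_similarity_ratio(1)[OF f, of 0] \<theta>(2)[of 0] by linarith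
  have near: "dist (?s m) (?s n) \<le> \<theta> ^ n" if nm: "n \<le> m" for n m
  proof -
    obtain t where t: "t \<in> {0..1}" "?s m = foldr f [0..<n] t" using tail[OF nm] by blast
    have "dist (?s m) (?s n) = (\<Prod>k<n. contraction_ratio (f k)) * dist t 0"
      using dist_foldr_similarity[of f t 0 n, OF f t(1)] t(2) by simp
    also have "\<dots> \<le> \<theta> ^ n * 1"
      using t(1) prod_le \<theta>0 by (intro mult_mono) (auto simp: dist_real_def)
    finally show ?thesis by simp
  qed
  have "Cauchy ?s"
  proof (rule metric_CauchyI)
    fix e :: real assume "0 < e"
    then obtain M where M: "\<theta> ^ M < e / 2"
      using real_arch_pow_inv[of "e / 2" \<theta>] \<theta>(1) by auto
    have "dist (?s m) (?s n) < e" if "M \<le> m" "M \<le> n" for m n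
      using near[OF that(1)] near[OF that(2)] M dist_triangle2[of "?s m" "?s n" "?s M"] by linarith
    then show "\<exists>M. \<forall>m\<ge>M. \<forall>n\<ge>M. dist (?s m) (?s n) < e" by blast
  qed
  then obtain l where l: "?s \<longlonglongrightarrow> l" using Cauchy_convergent_iff convergent_def by blast
  moreover have "\<exists>t\<in>{0..1}. l = foldr f [0..<n] t" for n
  proof -
    have "continuous_on {0..1} (foldr f [0..<n])"
    proof (rule lipschitz_on_continuous_on)
      show "(\<Prod>k<n. contraction_ratio (f k))-lipschitz_on {0..1} (foldr f [0..<n])"
        using dist_foldr_similarity[of f, OF f] contracting_similarity_ratio(1)[OF f]
        by (intro lipschitz_onI) (auto intro!: prod_nonneg simp: less_imp_le)
    qed
    then have "closed (foldr f [0..<n] ` {0..1})"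
      by (intro compact_imp_closed compact_continuous_image) auto
    moreover have "\<forall>\<^sub>F m in sequentially. ?s m \<in> foldr f [0..<n] ` {0..1}"
      using tail by (intro eventually_sequentiallyI[of n]) blast
    ultimately have "l \<in> foldr f [0..<n] ` {0..1}"
      using l by (intro Lim_in_closed_set) auto
    then show ?thesis by blast
  qed
  ultimately show ?thesis using that by blast
qed

section \<open>Diagonal IFS and the coordinates of the coding map\<close>

lemma diagonal_IFS_similarity:
  assumes "diagonal_IFS A \<phi> E" "a \<in> E"
  shows "contracting_similarity (\<phi> i (a i))"
  using assms unfolding diagonal_IFS_def by blast

lemma diagonal_IFS_ratio:
  assumes "diagonal_IFS A \<phi> E" "a \<in> E"
  shows "0 < ratio \<phi> a i" "ratio \<phi> a i < 1"
  using contracting_similarity_ratio[OF diagonal_IFS_similarity[OF assms]] unfolding ratio_def by auto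

lemma diagonal_IFS_finite:
  assumes "diagonal_IFS A \<phi> E"
  shows "finite E"
proof (rule finite_subset)
  show "E \<subseteq> Pi\<^sub>E UNIV A" using assms unfolding diagonal_IFS_def by simp
  show "finite (Pi\<^sub>E UNIV A)"
    using assms unfolding diagonal_IFS_def by (intro finite_PiE) simp_all
qed

lemma finite_uniform_less_one:
  assumes "finite E" "\<And>a. a \<in> E \<Longrightarrow> f a < (1::real)"
  obtains \<theta> where "0 < \<theta>" "\<theta> < 1" "\<And>a. a \<in> E \<Longrightarrow> f a \<le> \<theta>"
proof
  \<comment> \<open>The inserted value makes the maximum exist and be positive, whatever
    \<open>E\<close> and the signs of \<open>f\<close> are.\<close>
  let ?S = "insert (1/2) (f ` E)"
  show "0 < Max ?S" using assms(1) by (intro less_le_trans[OF _ Max_ge[of _ "1/2"]]) auto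
  show "Max ?S < 1" using assms by (subst Max_less_iff) auto
  show "f a \<le> Max ?S" if "a \<in> E" for a using assms(1) that by (intro Max_ge) auto
qed

lemma finite_uniform_pos:
  assumes "finite E" "\<And>a. a \<in> E \<Longrightarrow> 0 < (f a :: real)"
  obtains \<delta> where "0 < \<delta>" "\<delta> \<le> 1" "\<And>a. a \<in> E \<Longrightarrow> \<delta> \<le> f a"
proof
  \<comment> \<open>The inserted 1 covers empty \<open>E\<close> and gives
    \<open>\<delta> \<le> 1\<close>.\<close>
  let ?S = "insert 1 (f ` E)"
  show "0 < Min ?S" using assms by (subst Min_gr_iff) auto
  show "Min ?S \<le> 1" using assms(1) by (intro Min_le) auto
  show "Min ?S \<le> f a" if "a \<in> E" for a using assms(1) that by (intro Min_le) auto
qed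

lemma foldr_diag_map_nth:
  "foldr (\<lambda>k. diag_map \<phi> (\<omega> k)) xs x $ i = foldr (\<lambda>k. \<phi> i (\<omega> k i)) xs (x $ i)"
  by (induction xs) (simp_all add: diag_map_def)

text \<open>Diagonal maps act on each coordinate separately, so the limit exists coordinate by
  coordinate. Each coordinate of the limit lies in the corresponding side of every cylinder of the
  word.\<close>

lemma coding_map_nth:
  assumes IFS: "diagonal_IFS A \<phi> E" and \<omega>: "\<And>k. \<omega> k \<in> E"
  shows "\<exists>t\<in>{0..1}. coding_map \<phi> \<omega> $ i = foldr (\<lambda>k. \<phi> i (\<omega> k i)) [0..<n] t"
proof -
  have "\<exists>l. (\<lambda>n. foldr (\<lambda>k. \<phi> j (\<omega> k j)) [0..<n] 0) \<longlonglongrightarrow> l \<and>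
      (\<forall>n. \<exists>t\<in>{0..1}. l = foldr (\<lambda>k. \<phi> j (\<omega> k j)) [0..<n] t)" for j
  proof -
    obtain \<theta> where \<theta>: "\<theta> < 1" "\<And>a. a \<in> E \<Longrightarrow> ratio \<phi> a j \<le> \<theta>"
      using finite_uniform_less_one[OF diagonal_IFS_finite[OF IFS], of "\<lambda>a. ratio \<phi> a j"]
        diagonal_IFS_ratio(2)[OF IFS] by metis
    have "contracting_similarity (\<phi> j (\<omega> k j))" for k
      using diagonal_IFS_similarity[OF IFS \<omega>] .
    moreover have "contraction_ratio (\<phi> j (\<omega> k j)) \<le> \<theta>" for k
      using \<theta>(2)[OF \<omega>] unfolding ratio_def .
    ultimately show ?thesis
      using foldr_similarity_limit[of "\<lambda>k. \<phi> j (\<omega> k j)" \<theta>] \<theta>(1) by blast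
  qed
  then obtain l where l: "\<And>j. (\<lambda>n. foldr (\<lambda>k. \<phi> j (\<omega> k j)) [0..<n] 0) \<longlonglongrightarrow> l j"
      "\<And>j n. \<exists>t\<in>{0..1}. l j = foldr (\<lambda>k. \<phi> j (\<omega> k j)) [0..<n] t"
    by metis
  have "(\<lambda>n. foldr (\<lambda>k. diag_map \<phi> (\<omega> k)) [0..<n] 0) \<longlonglongrightarrow> (\<chi> j. l j)"
    by (rule vec_tendstoI) (simp add: foldr_diag_map_nth l(1))
  then have "coding_map \<phi> \<omega> = (\<chi> j. l j)" unfolding coding_map_def by (rule limI)
  then show ?thesis using l(2) by simp
qed

section \<open>Uniform separation from strong goodness\<close>

text \<open>If two boxes have sides that meet in every coordinate, then a common point of the boxes
  can be assembled coordinate by coordinate.\<close>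

lemma strongly_good_disjoint_side:
  assumes good: "strongly_good \<phi> E I" and ab: "a \<in> E" "b \<in> E" "\<not> (\<forall>j\<in>I. a j = b j)"
  shows "\<exists>j\<in>I. \<phi> j (a j) ` {0..1} \<inter> \<phi> j (b j) ` {0..1} = {}"
proof (rule ccontr)
  assume "\<not> ?thesis"
  then have "\<forall>j\<in>I. \<exists>s\<in>{0..1}. \<exists>t\<in>{0..1}. \<phi> j (a j) s = \<phi> j (b j) t" by blast
  then obtain s t where st: "\<And>j. j \<in> I \<Longrightarrow> s j \<in> {0..1} \<and> t j \<in> {0..1} \<and> \<phi> j (a j) (s j) = \<phi> j (b j) (t j)"
    by metis
  \<comment> \<open>The disjoint family is indexed by restricted letters, so the restrictions
    themselves must be distinct.\<close>
  have "restrict a I \<noteq> restrict b I" using ab(3) by (metis restrict_apply')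
  then have "partial_map \<phi> I (restrict a I) ` (I \<rightarrow>\<^sub>E {0..1}) \<inter>
      partial_map \<phi> I (restrict b I) ` (I \<rightarrow>\<^sub>E {0..1}) = {}"
    using good ab(1,2) unfolding strongly_good_def disjoint_family_on_def by blast
  moreover have "restrict s I \<in> I \<rightarrow>\<^sub>E {0..1}" "restrict t I \<in> I \<rightarrow>\<^sub>E {0..1}" using st by auto
  moreover have "partial_map \<phi> I (restrict a I) (restrict s I) =
      partial_map \<phi> I (restrict b I) (restrict t I)"
    unfolding partial_map_def using st by (intro restrict_ext) simp
  ultimately show False by blast
qed

text \<open>Disjoint compact sides are a positive distance apart, and there are only finitely many
  pairs of letters. The bound \<open>\<delta> \<le> 1\<close> later keeps the radius at most
  1.\<close>

lemma strongly_good_gap: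
  assumes IFS: "diagonal_IFS A \<phi> E" and good: "strongly_good \<phi> E I"
  obtains \<delta> where "0 < \<delta>" "\<delta> \<le> 1"
    and "\<forall>a\<in>E. \<forall>b\<in>E. \<not> (\<forall>j\<in>I. a j = b j) \<longrightarrow>
      (\<exists>j\<in>I. \<forall>s\<in>{0..1}. \<forall>t\<in>{0..1}. \<delta> \<le> dist (\<phi> j (a j) s) (\<phi> j (b j) t))"
proof -
  define P where "P = (\<lambda>(a, b). \<lambda>\<delta>::real. \<not> (\<forall>j\<in>I. a j = b j) \<longrightarrow>
      (\<exists>j\<in>I. \<forall>s\<in>{0..1}. \<forall>t\<in>{0..1}. \<delta> \<le> dist (\<phi> j (a j) s) (\<phi> j (b j) t)))"
  have "\<exists>\<delta>>0. P p \<delta>" if p_mem: "p \<in> E \<times> E" for p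
  proof -
    obtain a b where p: "p = (a, b)" and ab: "a \<in> E" "b \<in> E" using p_mem by blast
    show ?thesis
    proof (cases "\<forall>j\<in>I. a j = b j")
      case True
      then show ?thesis using p unfolding P_def by (intro exI[of _ 1]) auto
    next
      case False
      then obtain j where j: "j \<in> I" "\<phi> j (a j) ` {0..1} \<inter> \<phi> j (b j) ` {0..1} = {}"
        using strongly_good_disjoint_side[OF good ab] by blast
      have "compact (\<phi> j (c j) ` {0..1})" if "c \<in> E" for c
        using contracting_similarity_continuous_on[OF diagonal_IFS_similarity[OF IFS that]]
        by (intro compact_continuous_image) auto
      then obtain d where "d > 0" "\<forall>x\<in>\<phi> j (a j) ` {0..1}. \<forall>y\<in>\<phi> j (b j) ` {0..1}. d \<le> dist x y"
        using separate_compact_closed[OF _ compact_imp_closed j(2)] ab by blast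
      then show ?thesis using j(1) p unfolding P_def by (intro exI[of _ d]) auto
    qed
  qed
  then obtain g where g: "\<And>p. p \<in> E \<times> E \<Longrightarrow> 0 < g p \<and> P p (g p)" by metis
  obtain \<delta> where \<delta>: "0 < \<delta>" "\<delta> \<le> 1" "\<And>p. p \<in> E \<times> E \<Longrightarrow> \<delta> \<le> g p"
    using finite_uniform_pos[of "E \<times> E" g] diagonal_IFS_finite[OF IFS] g by blast
  show ?thesis
  proof (rule that[OF \<delta>(1,2)], intro ballI impI)
    fix a b assume ab: "a \<in> E" "b \<in> E" "\<not> (\<forall>j\<in>I. a j = b j)"
    then obtain j where "j \<in> I" "\<forall>s\<in>{0..1}. \<forall>t\<in>{0..1}. g (a, b) \<le> dist (\<phi> j (a j) s) (\<phi> j (b j) t)"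
      using g[of "(a, b)"] unfolding P_def by auto
    then show "\<exists>j\<in>I. \<forall>s\<in>{0..1}. \<forall>t\<in>{0..1}. \<delta> \<le> dist (\<phi> j (a j) s) (\<phi> j (b j) t)"
      using \<delta>(3)[of "(a, b)"] ab(1,2) by (meson SigmaI order_trans)
  qed
qed

section \<open>Distances between points of the sponge and their words\<close>

text \<open>In the directions of \<open>I\<close> the common prefix applies the same similarities to
  both points, so it scales the gap produced by the letters at \<open>n\<close> by the product of
  its ratios.\<close>

lemma coding_map_separation:
  assumes IFS: "diagonal_IFS A \<phi> E" and \<omega>: "\<And>k. \<omega> k \<in> E" and \<tau>: "\<And>k. \<tau> k \<in> E"
    and gap: "\<forall>a\<in>E. \<forall>b\<in>E. \<not> (\<forall>j\<in>I. a j = b j) \<longrightarrow>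
      (\<exists>j\<in>I. \<forall>s\<in>{0..1}. \<forall>t\<in>{0..1}. \<delta> \<le> dist (\<phi> j (a j) s) (\<phi> j (b j) t))"
    and agree: "\<forall>k<n. \<forall>j\<in>I. \<omega> k j = \<tau> k j"
    and differ: "\<not> (\<forall>j\<in>I. \<omega> n j = \<tau> n j)"
  shows "\<exists>j\<in>I. (\<Prod>k<n. ratio \<phi> (\<omega> k) j) * \<delta> \<le> dist (coding_map \<phi> \<omega>) (coding_map \<phi> \<tau>)"
proof -
  obtain j where j: "j \<in> I"
      "\<And>s t. s \<in> {0..1} \<Longrightarrow> t \<in> {0..1} \<Longrightarrow> \<delta> \<le> dist (\<phi> j (\<omega> n j) s) (\<phi> j (\<tau> n j) t)"
    using gap[rule_format, OF \<omega> \<tau> differ] by blast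
  let ?F = "foldr (\<lambda>k. \<phi> j (\<omega> k j)) [0..<n]"
  \<comment> \<open>Level \<open>Suc n\<close> exposes letter \<open>n\<close> as the innermost map,
    which is where the gap applies.\<close>
  obtain s where s: "s \<in> {0..1}" "coding_map \<phi> \<omega> $ j = ?F (\<phi> j (\<omega> n j) s)"
    using coding_map_nth[where \<omega>=\<omega> and i=j and n="Suc n", OF IFS \<omega>] by auto
  obtain t where t: "t \<in> {0..1}" "coding_map \<phi> \<tau> $ j = foldr (\<lambda>k. \<phi> j (\<tau> k j)) [0..<n] (\<phi> j (\<tau> n j) t)"
    using coding_map_nth[where \<omega>=\<tau> and i=j and n="Suc n", OF IFS \<tau>] by auto
  have "foldr (\<lambda>k. \<phi> j (\<tau> k j)) [0..<n] (\<phi> j (\<tau> n j) t) = ?F (\<phi> j (\<tau> n j) t)"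
    using agree j(1) by (intro foldr_cong) auto
  then have "dist (coding_map \<phi> \<omega> $ j) (coding_map \<phi> \<tau> $ j) =
      (\<Prod>k<n. ratio \<phi> (\<omega> k) j) * dist (\<phi> j (\<omega> n j) s) (\<phi> j (\<tau> n j) t)"
    using dist_foldr_similarity[of "\<lambda>k. \<phi> j (\<omega> k j)" "\<phi> j (\<omega> n j) s" "\<phi> j (\<tau> n j) t" n]
      diagonal_IFS_similarity[OF IFS \<omega>] s t
      contracting_similarity_mem[OF diagonal_IFS_similarity[OF IFS \<omega>] s(1)]
      contracting_similarity_mem[OF diagonal_IFS_similarity[OF IFS \<tau>] t(1)]
    by (simp add: ratio_def)
  moreover have "0 \<le> (\<Prod>k<n. ratio \<phi> (\<omega> k) j)"
    using diagonal_IFS_ratio(1)[OF IFS \<omega>] by (intro prod_nonneg) (simp add: less_imp_le)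
  ultimately have "(\<Prod>k<n. ratio \<phi> (\<omega> k) j) * \<delta> \<le> dist (coding_map \<phi> \<omega> $ j) (coding_map \<phi> \<tau> $ j)"
    using j(2)[OF s(1) t(1)] by (simp add: mult_left_mono)
  then show ?thesis using j(1) dist_vec_nth_le order_trans by blast
qed

text \<open>Both coordinates lie in the image of \<open>{0..1}\<close> under one composition of
  \<open>n\<close> maps, and the product is the length of that image.\<close>

lemma coding_map_nth_close:
  assumes IFS: "diagonal_IFS A \<phi> E" and \<omega>: "\<And>k. \<omega> k \<in> E" and \<tau>: "\<And>k. \<tau> k \<in> E"
    and agree: "\<And>k. k < n \<Longrightarrow> \<omega> k i = \<tau> k i"
  shows "dist (coding_map \<phi> \<omega> $ i) (coding_map \<phi> \<tau> $ i) \<le> (\<Prod>k<n. ratio \<phi> (\<omega> k) i)"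
proof -
  let ?F = "foldr (\<lambda>k. \<phi> i (\<omega> k i)) [0..<n]"
  obtain s where s: "s \<in> {0..1}" "coding_map \<phi> \<omega> $ i = ?F s"
    using coding_map_nth[where \<omega>=\<omega>, OF IFS \<omega>] by blast
  obtain t where t: "t \<in> {0..1}" "coding_map \<phi> \<tau> $ i = foldr (\<lambda>k. \<phi> i (\<tau> k i)) [0..<n] t"
    using coding_map_nth[where \<omega>=\<tau>, OF IFS \<tau>] by blast
  have "foldr (\<lambda>k. \<phi> i (\<tau> k i)) [0..<n] t = ?F t"
    using agree by (intro foldr_cong) auto
  then have "dist (coding_map \<phi> \<omega> $ i) (coding_map \<phi> \<tau> $ i) = (\<Prod>k<n. ratio \<phi> (\<omega> k) i) * dist s t"
    using dist_foldr_similarity[of "\<lambda>k. \<phi> i (\<omega> k i)" s t n]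
      diagonal_IFS_similarity[OF IFS \<omega>] s t by (simp add: ratio_def)
  also have "\<dots> \<le> (\<Prod>k<n. ratio \<phi> (\<omega> k) i)"
    using s(1) t(1) diagonal_IFS_ratio(1)[OF IFS \<omega>]
    by (intro mult_left_le prod_nonneg) (auto simp: dist_real_def less_imp_le)
  finally show ?thesis .
qed

text \<open>The level \<open>N\<close> depends on \<open>\<beta>\<close> but not on
  \<open>x\<close>; the radius is then adapted to the cylinder of \<open>x\<close> of that
  level.\<close>

lemma sponge_flat_coordinate:
  fixes \<phi> :: "'n::finite \<Rightarrow> 'a \<Rightarrow> real \<Rightarrow> real"
  assumes IFS: "diagonal_IFS A \<phi> E" and good: "strongly_good \<phi> E I"
    and less: "\<forall>a\<in>E. \<forall>j\<in>I. ratio \<phi> a i < ratio \<phi> a j"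
    and determined: "\<forall>a\<in>E. \<forall>b\<in>E. (\<forall>j\<in>I. a j = b j) \<longrightarrow> a i = b i"
    and x: "x \<in> sponge \<phi> E" and "0 < \<beta>"
  shows "\<exists>\<rho>>0. \<rho> \<le> 1 \<and> (\<forall>y\<in>sponge \<phi> E. dist x y \<le> \<rho> \<longrightarrow> dist (x $ i) (y $ i) \<le> \<beta> * \<rho>)"
proof -
  obtain \<omega> where \<omega>: "\<And>k. \<omega> k \<in> E" and x_eq: "x = coding_map \<phi> \<omega>"
    using x unfolding sponge_def by blast
  obtain \<delta> where \<delta>: "0 < \<delta>" "\<delta> \<le> 1"
    and gap: "\<forall>a\<in>E. \<forall>b\<in>E. \<not> (\<forall>j\<in>I. a j = b j) \<longrightarrow>
      (\<exists>j\<in>I. \<forall>s\<in>{0..1}. \<forall>t\<in>{0..1}. \<delta> \<le> dist (\<phi> j (a j) s) (\<phi> j (b j) t))"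
    using strongly_good_gap[OF IFS good] by blast
  \<comment> \<open>The 1 covers the case that \<open>I\<close> is empty.\<close>
  define p where "p a = Min (insert 1 (ratio \<phi> a ` I))" for a
  have p_le: "p a \<le> 1" "\<And>j. j \<in> I \<Longrightarrow> p a \<le> ratio \<phi> a j" for a
    unfolding p_def by (intro Min_le; simp)+
  have p_gr: "ratio \<phi> a i < p a" if "a \<in> E" for a
    unfolding p_def using less that diagonal_IFS_ratio(2)[OF IFS that]
    by (subst Min_gr_iff) auto
  have p_pos: "0 < p a" if "a \<in> E" for a
    using p_gr[OF that] diagonal_IFS_ratio(1)[OF IFS that, of i] by linarith
  \<comment> \<open>Finiteness of \<open>E\<close> turns the strict inequalities \<open>p_gr\<close>
    into one factor \<open>\<theta>\<close>, gained with every letter.\<close>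
  obtain \<theta> where \<theta>: "0 < \<theta>" "\<theta> < 1" "\<And>a. a \<in> E \<Longrightarrow> ratio \<phi> a i / p a \<le> \<theta>"
    using finite_uniform_less_one[OF diagonal_IFS_finite[OF IFS], of "\<lambda>a. ratio \<phi> a i / p a"]
      p_gr p_pos by auto
  obtain N where N: "\<theta> ^ N < \<beta> * \<delta> / 2"
    using real_arch_pow_inv[of "\<beta> * \<delta> / 2" \<theta>] \<theta>(2) \<delta>(1) \<open>0 < \<beta>\<close> by auto
  \<comment> \<open>A lower bound for the sides of the cylinder in all directions of
    \<open>I\<close> at once: the product of the minima is at most the product of the ratios in any
    one direction.\<close>
  define P where "P = (\<Prod>k<N. p (\<omega> k))"
  have P: "0 < P" "P \<le> 1"
    unfolding P_def using p_pos[OF \<omega>] p_le(1) by (auto intro!: prod_pos prod_le_1 simp: less_imp_le)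
  have side: "(\<Prod>k<N. ratio \<phi> (\<omega> k) i) \<le> \<beta> * (\<delta> / 2 * P)"
  proof -
    have "(\<Prod>k<N. ratio \<phi> (\<omega> k) i) \<le> (\<Prod>k<N. \<theta> * p (\<omega> k))"
      using \<theta>(3)[OF \<omega>] p_pos[OF \<omega>] diagonal_IFS_ratio(1)[OF IFS \<omega>]
      by (intro prod_mono) (simp add: field_simps less_imp_le)
    also have "\<dots> = \<theta> ^ N * P" by (simp add: prod.distrib P_def)
    also have "\<dots> \<le> \<beta> * \<delta> / 2 * P" using N P(1) by (simp add: mult_right_mono)
    finally show ?thesis by simp
  qed
  show ?thesis
  \<comment> \<open>Halving puts the radius strictly below \<open>P * \<delta>\<close>, since
    closeness is a non-strict inequality.\<close>
  proof (intro exI[of _ "\<delta> / 2 * P"] conjI ballI impI)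
    show "0 < \<delta> / 2 * P" using \<delta>(1) P(1) by simp
    show "\<delta> / 2 * P \<le> 1" using \<delta> P by (intro mult_le_one) auto
    fix y assume "y \<in> sponge \<phi> E" and close: "dist x y \<le> \<delta> / 2 * P"
    then obtain \<tau> where \<tau>: "\<And>k. \<tau> k \<in> E" and y_eq: "y = coding_map \<phi> \<tau>"
      unfolding sponge_def by blast
    \<comment> \<open>Strong induction makes \<open>n\<close> the first place of disagreement, as
      the separation lemma requires.\<close>
    have agree: "\<forall>j\<in>I. \<omega> n j = \<tau> n j" if "n < N" for n
      using that
    proof (induction n rule: less_induct)
      case (less n)
      show ?case
      proof (rule ccontr)
        assume differ: "\<not> ?thesis"
        have "\<omega> k j = \<tau> k j" if "k < n" "j \<in> I" for k j
          using less.IH[OF that(1)] less.prems that by simp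
        then have "\<forall>k<n. \<forall>j\<in>I. \<omega> k j = \<tau> k j" by blast
        then have "\<exists>j\<in>I. (\<Prod>k<n. ratio \<phi> (\<omega> k) j) * \<delta> \<le> dist x y"
          unfolding x_eq y_eq
          by (rule coding_map_separation[of A \<phi> E \<omega> \<tau> I \<delta> n, OF IFS \<omega> \<tau> gap _ differ])
        then obtain j where j: "j \<in> I" "(\<Prod>k<n. ratio \<phi> (\<omega> k) j) * \<delta> \<le> dist x y" by blast
        \<comment> \<open>Separation involves only the first \<open>n\<close> letters; the remaining
          factors of \<open>P\<close> are at most 1, so the bound by \<open>P\<close> holds for
          every \<open>n < N\<close>.\<close>
        have "P = (\<Prod>k<n. p (\<omega> k)) * (\<Prod>k=n..<N. p (\<omega> k))"
          unfolding P_def using less.prems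
          by (simp add: lessThan_atLeast0 prod.atLeastLessThan_concat)
        also have "\<dots> \<le> (\<Prod>k<n. p (\<omega> k))"
          using p_pos[OF \<omega>] p_le(1) by (intro mult_left_le prod_le_1 prod_nonneg) (auto simp: less_imp_le)
        also have "\<dots> \<le> (\<Prod>k<n. ratio \<phi> (\<omega> k) j)"
          using p_pos[OF \<omega>] p_le(2)[OF j(1)] by (intro prod_mono) (auto simp: less_imp_le)
        finally have "P * \<delta> \<le> dist x y"
          using j(2) \<delta>(1) by (meson less_imp_le mult_right_mono order_trans)
        moreover have "0 < P * \<delta>" using P(1) \<delta>(1) by simp
        ultimately show False using close by (simp add: field_simps)
      qed
    qed
    then have "\<omega> n i = \<tau> n i" if "n < N" for n
      using determined \<omega> \<tau> that by blast
    then have "dist (x $ i) (y $ i) \<le> (\<Prod>k<N. ratio \<phi> (\<omega> k) i)"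
      unfolding x_eq y_eq by (rule coding_map_nth_close[where \<omega>=\<omega> and \<tau>=\<tau>, OF IFS \<omega> \<tau>])
    then show "dist (x $ i) (y $ i) \<le> \<beta> * (\<delta> / 2 * P)" using side by linarith
  qed
qed

section \<open>Coordinate hyperplanes and failure of diffuseness\<close>

lemma infdist_coordinate_hyperplane_le:
  fixes y :: "real ^ 'n::finite"
  shows "infdist y {z. axis i 1 \<bullet> z = c} \<le> dist c (y $ i)"
proof -
  \<comment> \<open>Moving \<open>y\<close> along the axis of \<open>i\<close> brings it onto the
    hyperplane.\<close>
  have "y + (c - y $ i) *\<^sub>R axis i 1 \<in> {z. axis i 1 \<bullet> z = c}"
    by (simp add: inner_axis')
  then have "infdist y {z. axis i 1 \<bullet> z = c} \<le> dist y (y + (c - y $ i) *\<^sub>R axis i 1)"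
    by (rule infdist_le)
  also have "\<dots> = dist c (y $ i)" by (simp add: dist_norm)
  finally show ?thesis .
qed

text \<open>Diffuseness is demanded at all points, radii and hyperplanes, so a single
  \<open>x\<close> suffices, with one radius for each \<open>\<beta>\<close> and the hyperplane
  through \<open>x\<close> orthogonal to the axis of \<open>i\<close>.\<close>

lemma not_hyperplane_diffuseI:
  fixes K :: "(real ^ 'n::finite) set"
  assumes "x \<in> K"
    and flat: "\<And>\<beta>. 0 < \<beta> \<Longrightarrow>
      \<exists>\<rho>>0. \<rho> \<le> 1 \<and> (\<forall>y\<in>K. dist x y \<le> \<rho> \<longrightarrow> dist (x $ i) (y $ i) \<le> \<beta> * \<rho>)"
  shows "\<not> hyperplane_diffuse K"
proof
  assume "hyperplane_diffuse K"
  then obtain \<beta> where "0 < \<beta>" and diffuse: "\<And>\<rho> x L. 0 < \<rho> \<Longrightarrow> \<rho> \<le> 1 \<Longrightarrow> x \<in> K \<Longrightarrow>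
      affine_hyperplane L \<Longrightarrow> (cball x \<rho> \<inter> K) - {y. infdist y L \<le> \<beta> * \<rho>} \<noteq> {}"
    unfolding hyperplane_diffuse_def by blast
  then obtain \<rho> where \<rho>: "0 < \<rho>" "\<rho> \<le> 1"
      "\<forall>y\<in>K. dist x y \<le> \<rho> \<longrightarrow> dist (x $ i) (y $ i) \<le> \<beta> * \<rho>"
    using flat by blast
  let ?L = "{z. axis i (1::real) \<bullet> z = x $ i}"
  have "affine_hyperplane ?L"
    unfolding affine_hyperplane_def by (intro exI[of _ "axis i (1::real)"] exI[of _ "x $ i"]) simp
  from diffuse[OF \<rho>(1,2) assms(1) this]
  obtain y where "y \<in> (cball x \<rho> \<inter> K) - {y. infdist y ?L \<le> \<beta> * \<rho>}" by blast
  then have "y \<in> K" "dist x y \<le> \<rho>" "\<beta> * \<rho> < infdist y ?L" by simp_all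
  then show False
    using \<rho>(3) infdist_coordinate_hyperplane_le[of y i "x $ i"] by (meson leD order_trans)
qed

section \<open>Reducibility in terms of the coordinate ordering\<close>

text \<open>Here \<open>I\<close> consists of the coordinates before \<open>i\<close> in the
  ordering. At a coordinate \<open>i\<close> where irreducibility fails, letters that differ in
  \<open>i\<close> also differ in some \<open>j\<close> that does not satisfy
  \<open>coord_prec \<phi> E i j\<close>. The ordering is the same for all letters, so such a
  \<open>j\<close> comes before \<open>i\<close>.\<close>

lemma reducible_coordinate:
  fixes \<phi> :: "'n::finite \<Rightarrow> 'a \<Rightarrow> real \<Rightarrow> real"
  assumes LG: "strongly_Lalley_Gatzouras \<phi> E" and red: "\<not> irreducible_sponge \<phi> E"
  obtains i I where "strongly_good \<phi> E I"
    and "\<forall>a\<in>E. \<forall>j\<in>I. ratio \<phi> a i < ratio \<phi> a j"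
    and "\<forall>a\<in>E. \<forall>b\<in>E. (\<forall>j\<in>I. a j = b j) \<longrightarrow> a i = b i"
proof -
  obtain \<sigma> where \<sigma>: "bij_betw \<sigma> {1..CARD('n)} (UNIV :: 'n set)"
    and step: "\<And>a k. a \<in> E \<Longrightarrow> k \<in> {1..<CARD('n)} \<Longrightarrow> ratio \<phi> a (\<sigma> (Suc k)) < ratio \<phi> a (\<sigma> k)"
    and good: "\<And>k. k \<in> {1..CARD('n)} \<Longrightarrow> strongly_good \<phi> E (\<sigma> ` {1..k})"
    using LG unfolding strongly_Lalley_Gatzouras_def by blast
  have mono: "ratio \<phi> a (\<sigma> m) < ratio \<phi> a (\<sigma> l)"
    if "a \<in> E" "1 \<le> l" "l < m" "m \<le> CARD('n)" for a l m
    using that(3,4)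
  proof (induction m)
    case (Suc m)
    then have "ratio \<phi> a (\<sigma> (Suc m)) < ratio \<phi> a (\<sigma> m)" using step[OF that(1)] that(2) by auto
    then show ?case using Suc by (cases "l = m") auto
  qed simp
  obtain i where i: "\<And>a b. a \<in> E \<Longrightarrow> b \<in> E \<Longrightarrow> a i \<noteq> b i \<Longrightarrow> \<exists>j. a j \<noteq> b j \<and> \<not> coord_prec \<phi> E i j"
    using red unfolding irreducible_sponge_def by blast
  obtain k where k: "k \<in> {1..CARD('n)}" "i = \<sigma> k" using \<sigma> unfolding bij_betw_def by blast
  show ?thesis
  proof
    \<comment> \<open>The hypothesis covers only nonempty initial segments. For \<open>k = 1\<close>
      the set is empty, all letters have the same restriction, and disjointness is trivial.\<close>
    show "strongly_good \<phi> E (\<sigma> ` {1..<k})"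
    proof (cases "k = 1")
      case True
      then show ?thesis by (auto simp: strongly_good_def disjoint_family_on_def)
    next
      case False
      then have "k - 1 \<in> {1..CARD('n)}" "{1..<k} = {1..k - 1}" using k(1) by auto
      then show ?thesis using good by metis
    qed
    show "\<forall>a\<in>E. \<forall>j\<in>\<sigma> ` {1..<k}. ratio \<phi> a i < ratio \<phi> a j"
      using k mono by auto
    have "a i = b i" if ab: "a \<in> E" "b \<in> E" "\<forall>j\<in>\<sigma> ` {1..<k}. a j = b j" for a b
    proof (rule ccontr)
      assume "a i \<noteq> b i"
      then obtain j where j: "a j \<noteq> b j" "\<not> coord_prec \<phi> E i j" using i ab(1,2) by blast
      obtain l where l: "l \<in> {1..CARD('n)}" "j = \<sigma> l" using \<sigma> unfolding bij_betw_def by blast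
      \<comment> \<open>Agreement on \<open>I\<close> forces \<open>j\<close> to be \<open>i\<close>
        or to come after it, where the ratios are at most those at \<open>i\<close>.\<close>
      have "\<not> l < k" using ab(3) j(1) l by auto
      then have "coord_prec \<phi> E i j"
        unfolding coord_prec_def using mono k l
        by (cases "k = l") (auto simp: less_imp_le)
      then show False using j(2) by blast
    qed
    then show "\<forall>a\<in>E. \<forall>b\<in>E. (\<forall>j\<in>\<sigma> ` {1..<k}. a j = b j) \<longrightarrow> a i = b i" by blast
  qed
qed

theorem proposition3p4:
  fixes A :: "'n::finite \<Rightarrow> 'a set"
    and \<phi> :: "'n \<Rightarrow> 'a \<Rightarrow> real \<Rightarrow> real"
    and E :: "('n \<Rightarrow> 'a) set"
  assumes "diagonal_IFS A \<phi> E"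
    and "strongly_Lalley_Gatzouras \<phi> E"
    and "\<not> irreducible_sponge \<phi> E"
  shows "\<forall>K. K \<subseteq> sponge \<phi> E \<and> K \<noteq> {} \<longrightarrow> \<not> hyperplane_diffuse K"
proof (intro allI impI, elim conjE)
  fix K assume K: "K \<subseteq> sponge \<phi> E" "K \<noteq> {}"
  then obtain x where x: "x \<in> K" by blast
  obtain i I where iI: "strongly_good \<phi> E I"
    "\<forall>a\<in>E. \<forall>j\<in>I. ratio \<phi> a i < ratio \<phi> a j"
    "\<forall>a\<in>E. \<forall>b\<in>E. (\<forall>j\<in>I. a j = b j) \<longrightarrow> a i = b i"
    using reducible_coordinate[OF assms(2,3)] .
  show "\<not> hyperplane_diffuse K"
  proof (rule not_hyperplane_diffuseI[OF x, of i])
    fix \<beta> :: real assume "0 < \<beta>"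
    \<comment> \<open>Flatness at \<open>x\<close> concerns all nearby points of the sponge, so it
      passes to the subset \<open>K\<close>.\<close>
    then show "\<exists>\<rho>>0. \<rho> \<le> 1 \<and> (\<forall>y\<in>K. dist x y \<le> \<rho> \<longrightarrow> dist (x $ i) (y $ i) \<le> \<beta> * \<rho>)"
      using sponge_flat_coordinate[OF assms(1) iI subsetD[OF K(1) x]] K(1) by (meson subsetD)
  qed
qed

end
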